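(* Let $G$ be a graph with $n=|V(G)|$ vertices, let $k$ be a nonnegative integer with $k\le n$, and let $\mathfrak{C}$ be a finite cyclic group that acts on $G$ (preserving adjacency) such that the action on $V(G)$ is free. Suppose that for each integer $j$ with $0\le j\le k$ there is a polynomial $f_j(q)$ such that $(\mathcal{I}_j(G),\mathfrak{C},f_j(q))$ exhibits the cyclic sieving phenomenon. Then $\mathfrak{C}$ acts on the whiskering $w(G)$, and $$\left(\mathcal{I}_k(w(G)),\ \mathfrak{C},\ \sum_{j=0}^k f_j(q)\begin{bmatrix} n-j\\ k-j\end{bmatrix}\right)$$ exhibits the cyclic sieving phenomenon.
   Context: All graphs are finite and simple. $\mathcal{I}_k(G)$ is the collection of independent sets of size $k$ of $G$. A group acts on a graph if it acts on its vertex set preserving the adjacency relation; it then acts on $\mathcal{I}_k(G)$ by $\mathfrak{g}S=\{\mathfrak{g}v:v\in S\}$. An action on a set is free if only the identity element fixes any point. Whiskering: given $G$ with vertex set $V$, let $V'=\{v':v\in V\}$ be a set disjoint from $V$ and in bijection with $V$ via $v\mapsto v'$. The graph $w(G)$ has vertex set $V\cup V'$ and its edges are the edges $uv$ of $G$ together with the edges $vv'$ for all $v\in V$. A group acting on $G$ acts on $w(G)$ by extending the action via $\mathfrak{g}(v')=(\mathfrak{g}(v))'$. $[m]=1+q+\cdots+q^{m-1}$, and $\begin{bmatrix} a\\ b\end{bmatrix}=\frac{[a]!}{[b]!\,[a-b]!}$ for $0\le b\le a$ is the $q$-binomial coefficient, with $[m]!=[1][2]\cdots[m]$. Cyclic sieving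 phenomenon (CSP): for a finite cyclic group $\mathfrak{C}$, a finite set $X$ and a polynomial $f(q)$, the triple $(X,\mathfrak{C},f(q))$ exhibits the CSP if $\mathfrak{C}$ acts on $X$ and for every $\mathfrak{g}\in\mathfrak{C}$ of order $d$ and every primitive $d$th root of unity $\omega\in\mathbb{C}$ we have $|X^{\mathfrak{g}}|=f(\omega)$, where $X^{\mathfrak{g}}=\{x\in X:\mathfrak{g}x=x\}$. *)

theory Defs
  imports
    Complex_Main
    "HOL-Computational_Algebra.Polynomial"
    "HOL-Algebra.Group_Action"
    "HOL-Algebra.Elementary_Groups"
    "HOL-Algebra.Multiplicative_Group"
    "Graph_Theory.Pair_Digraph"
begin

text \<open>
  A finite simple graph is a \<open>pair_graph\<close>: a finite loop-free digraph whose arc set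
  \<open>parcs G\<close> is a symmetric set of pairs, so an edge \<open>uv\<close> is present as both \<open>(u, v)\<close> and \<open>(v, u)\<close>
  and \<open>parcs G\<close> is the adjacency relation.
\<close>

definition indep_sets :: "'v pair_pre_digraph \<Rightarrow> nat \<Rightarrow> 'v set set" where
  "indep_sets G k = {S. S \<subseteq> pverts G \<and> card S = k \<and> (\<forall>u\<in>S. \<forall>v\<in>S. (u, v) \<notin> parcs G)}"

text \<open>The vertex \<open>v\<close> is \<open>Inl v\<close> and its copy \<open>v'\<close> is \<open>Inr v\<close>.\<close>

definition whiskering :: "'v pair_pre_digraph \<Rightarrow> ('v + 'v) pair_pre_digraph" where
  "whiskering G =
     \<lparr> pverts = Inl ` pverts G \<union> Inr ` pverts G,
       parcs = {(Inl u, Inl v) | u v. (u, v) \<in> parcs G}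
             \<union> {(Inl v, Inr v) | v. v \<in> pverts G}
             \<union> {(Inr v, Inl v) | v. v \<in> pverts G} \<rparr>"

lemma pair_graph_whiskering:
  assumes "pair_graph G"
  shows "pair_graph (whiskering G)"
proof -
  interpret pair_graph G by fact
  have "parcs (whiskering G) = map_prod Inl Inl ` parcs G
          \<union> (\<lambda>v. (Inl v, Inr v)) ` pverts G \<union> (\<lambda>v. (Inr v, Inl v)) ` pverts G"
    by (force simp: whiskering_def)
  then have "finite (parcs (whiskering G))"
    by (simp add: pair_finite_arcs pair_finite_verts)
  moreover have "sym (parcs G)"
    using pair_sym_arcs by (simp add: symmetric_def)
  then have "sym (parcs (whiskering G))"
    by (auto simp: whiskering_def sym_def)
  ultimately show ?thesis
    by unfold_locales
      (auto simp: whiskering_def symmetric_def pair_finite_verts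
            dest: in_arcsD1 in_arcsD2 pair_no_loops)
qed

text \<open>
  Actions are those of \<open>group_action\<close>, whose permutations are extensional functions;
  this is why the induced actions below are restricted to their domains.
\<close>

definition acts_on_graph ::
    "'g monoid \<Rightarrow> 'v pair_pre_digraph \<Rightarrow> ('g \<Rightarrow> 'v \<Rightarrow> 'v) \<Rightarrow> bool" where
  "acts_on_graph C G \<phi> \<longleftrightarrow>
     group_action C (pverts G) \<phi> \<and>
     (\<forall>g\<in>carrier C. \<forall>u\<in>pverts G. \<forall>v\<in>pverts G.
        (\<phi> g u, \<phi> g v) \<in> parcs G \<longleftrightarrow> (u, v) \<in> parcs G)"

definition free_action :: "'g monoid \<Rightarrow> 'x set \<Rightarrow> ('g \<Rightarrow> 'x \<Rightarrow> 'x) \<Rightarrow> bool" where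
  "free_action C X \<phi> \<longleftrightarrow>
     group_action C X \<phi> \<and> (\<forall>g\<in>carrier C. \<forall>x\<in>X. \<phi> g x = x \<longrightarrow> g = \<one>\<^bsub>C\<^esub>)"

definition set_action :: "'v set set \<Rightarrow> ('g \<Rightarrow> 'v \<Rightarrow> 'v) \<Rightarrow> 'g \<Rightarrow> 'v set \<Rightarrow> 'v set" where
  "set_action \<S> \<phi> g = (\<lambda>S\<in>\<S>. \<phi> g ` S)"

definition whiskering_action ::
    "'v pair_pre_digraph \<Rightarrow> ('g \<Rightarrow> 'v \<Rightarrow> 'v) \<Rightarrow> 'g \<Rightarrow> 'v + 'v \<Rightarrow> 'v + 'v" where
  "whiskering_action G \<phi> g = (\<lambda>x\<in>pverts (whiskering G). map_sum (\<phi> g) (\<phi> g) x)"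

definition q_int :: "nat \<Rightarrow> complex poly" where
  "q_int m = (\<Sum>i<m. Polynomial.monom 1 i)"

definition q_fact :: "nat \<Rightarrow> complex poly" where
  "q_fact m = (\<Prod>i=1..m. q_int i)"

text \<open>Meant for \<open>b \<le> a\<close>; the polynomial division is then exact (\<open>q_binomial_exact\<close>).\<close>

definition q_binomial :: "nat \<Rightarrow> nat \<Rightarrow> complex poly" where
  "q_binomial a b = q_fact a div (q_fact b * q_fact (a - b))"

lemma q_int_add: "q_int (a + b) = q_int a + Polynomial.monom 1 a * q_int b"
  by (induction b) (simp_all add: q_int_def algebra_simps Polynomial.mult_monom)

lemma q_fact_Suc: "q_fact (Suc m) = q_fact m * q_int (Suc m)"
  by (simp add: q_fact_def)

lemma q_fact_dvd: "q_fact a * q_fact b dvd q_fact (a + b)"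
proof (induction "a + b" arbitrary: a b)
  case 0
  then show ?case by (simp add: q_fact_def)
next
  case (Suc n)
  show ?case
  proof (cases "a = 0 \<or> b = 0")
    case True
    then show ?thesis by (auto simp: q_fact_def)
  next
    case False
    then obtain a' b' where ab: "a = Suc a'" "b = Suc b'"
      by (meson not0_implies_Suc)
    have n: "n = a' + b" "n = a + b'" using Suc.hyps(2) ab by auto
    have "q_fact (a + b) = q_fact n * (q_int a + Polynomial.monom 1 a * q_int b)"
      using Suc.hyps(2) by (metis q_fact_Suc q_int_add)
    also have "\<dots> = q_fact n * q_int a + Polynomial.monom 1 a * (q_fact n * q_int b)"
      by (simp add: algebra_simps)
    finally have eq: "q_fact (a + b) = \<dots>" .
    have "q_fact a * q_fact b = q_fact a' * q_fact b * q_int a"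
      by (simp add: ab q_fact_Suc ac_simps)
    then have "q_fact a * q_fact b dvd q_fact n * q_int a"
      using Suc.hyps(1)[OF n(1)] n(1) by (metis dvd_refl mult_dvd_mono)
    moreover have "q_fact a * q_fact b = q_fact a * q_fact b' * q_int b"
      by (simp add: ab q_fact_Suc ac_simps)
    then have "q_fact a * q_fact b dvd q_fact n * q_int b"
      using Suc.hyps(1)[OF n(2)] n(2) by (metis dvd_refl mult_dvd_mono)
    ultimately show ?thesis unfolding eq by (simp add: dvd_add dvd_mult)
  qed
qed

lemma q_binomial_exact:
  assumes "b \<le> a"
  shows "q_binomial a b * (q_fact b * q_fact (a - b)) = q_fact a"
  using q_fact_dvd[of b "a - b"] assms by (simp add: q_binomial_def)

definition primitive_root_of_unity :: "nat \<Rightarrow> complex \<Rightarrow> bool" where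
  "primitive_root_of_unity d \<omega> \<longleftrightarrow> d > 0 \<and> \<omega> ^ d = 1 \<and> (\<forall>m. 0 < m \<and> m < d \<longrightarrow> \<omega> ^ m \<noteq> 1)"

definition exhibits_csp ::
    "'g monoid \<Rightarrow> 'x set \<Rightarrow> ('g \<Rightarrow> 'x \<Rightarrow> 'x) \<Rightarrow> complex poly \<Rightarrow> bool" where
  "exhibits_csp C X \<phi> f \<longleftrightarrow>
     group C \<and> cyclic_group C \<and> finite (carrier C) \<and> finite X \<and> group_action C X \<phi> \<and>
     (\<forall>g\<in>carrier C. \<forall>\<omega>. primitive_root_of_unity (group.ord C g) \<omega> \<longrightarrow>
        of_nat (card (invariants X \<phi> g)) = poly f \<omega>)"

end

theory Submission
  imports Defs
begin

text \<open>
  An independent set of the whiskering is a disjoint union \<open>A <+> B\<close>, where \<open>A\<close> is independent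
  in \<open>G\<close> and the set \<open>B\<close> of bases of the chosen whisker tips avoids \<open>A\<close> but is otherwise
  arbitrary. It is fixed
  by a group element \<open>g\<close> iff \<open>g\<close> fixes \<open>A\<close> and \<open>B\<close> separately
  (\<open>card_invariant_indep_sets_whiskering\<close>). The number of \<open>g\<close>-invariant \<open>A\<close> of size \<open>j\<close> is
  \<open>f j\<close> at \<open>\<omega>\<close> by hypothesis, so everything rests on the number of \<open>g\<close>-invariant
  \<open>(k - j)\<close>-subsets \<open>B\<close> of the \<open>n - j\<close> vertices outside an invariant \<open>A\<close>. This number has to depend
  only on \<open>j\<close> and to be the value at \<open>\<omega>\<close> of the \<open>q\<close>-binomial coefficient.

  Both follow from freeness. Let \<open>d\<close> be the order of \<open>g\<close>. All cycles of \<open>g\<close> on vertices have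
  length exactly \<open>d\<close>, so an invariant subset either contains a given cycle or misses it; deleting
  a cycle shows that the number \<open>N a b\<close> of invariant \<open>b\<close>-subsets of an invariant \<open>a\<close>-set satisfies
  \<open>N (a + d) b = N a b + N a (b - d)\<close>, without the last term if \<open>b < d\<close>. At a primitive \<open>d\<close>-th root of unity the Gaussian binomial
  coefficients satisfy the same recurrence (\<open>poly_gauss_binomial_add_order\<close>), because those with upper
  index \<open>d\<close> vanish except at the two ends. Both start from the same values at \<open>a = 0\<close>, so they agree
  (\<open>card_invariant_subsets\<close>), and summing over \<open>j\<close> and \<open>A\<close> gives the theorem. If \<open>d\<close> does not
  divide \<open>n - j\<close>, there is no invariant \<open>A\<close> of size \<open>j\<close>, so \<open>f j\<close> vanishes at \<open>\<omega>\<close> and \<open>j\<close> contributes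
  nothing to either side.
\<close>

section \<open>Gaussian binomial coefficients at roots of unity\<close>

text \<open>
  The \<open>q\<close>-Pascal rule as a definition. Unlike the quotient of \<open>q\<close>-factorials, it is the right object
  for \<open>b > a\<close> as well (the value is \<open>0\<close>), so that the recurrences below hold for all \<open>a\<close> and \<open>b\<close>.
\<close>

fun gauss_binomial :: "nat \<Rightarrow> nat \<Rightarrow> complex poly" where
  "gauss_binomial a 0 = 1"
| "gauss_binomial 0 (Suc b) = 0"
| "gauss_binomial (Suc a) (Suc b) = gauss_binomial a b
    + Polynomial.monom 1 (Suc b) * gauss_binomial a (Suc b)"

lemma gauss_binomial_eq_0: "a < b \<Longrightarrow> gauss_binomial a b = 0"
  by (induction a b rule: gauss_binomial.induct) auto

lemma q_fact_0: "q_fact 0 = 1"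
  by (simp add: q_fact_def)

text \<open>
  This links the Pascal rule with the factorial formula: after clearing denominators, the two terms
  of the Pascal rule are the summands of \<open>q_int (b + a) = q_int b + q^b * q_int a\<close>, multiplied by
  \<open>q_fact (a + b - 1)\<close>.
\<close>

lemma gauss_binomial_mult_q_fact:
  "gauss_binomial (a + b) b * (q_fact b * q_fact a) = q_fact (a + b)"
proof (induction "a + b" arbitrary: a b)
  case 0
  then show ?case by (simp add: q_fact_0)
next
  case (Suc m)
  show ?case
  proof (cases b)
    case 0
    then show ?thesis by (simp add: q_fact_0)
  next
    case b: (Suc b')
    have m: "m = a + b'" using Suc.hyps(2) b by simp
    have fst: "gauss_binomial m b' * (q_fact b * q_fact a) = q_fact m * q_int b"
      using Suc.hyps(1)[OF m] m by (simp add: b q_fact_Suc mult.assoc mult.left_commute mult.commute)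
    have snd: "gauss_binomial m b * (q_fact b * q_fact a) = q_fact m * q_int a"
    proof (cases a)
      case 0
      then show ?thesis using m b by (simp add: gauss_binomial_eq_0 q_int_def)
    next
      case a: (Suc a')
      then have "m = a' + b" using m b by simp
      from Suc.hyps(1)[OF this] this show ?thesis
        by (simp add: a q_fact_Suc mult.assoc mult.left_commute mult.commute)
    qed
    have "gauss_binomial (a + b) b = gauss_binomial m b' + Polynomial.monom 1 b * gauss_binomial m b"
      by (simp add: b m)
    then have "gauss_binomial (a + b) b * (q_fact b * q_fact a)
        = gauss_binomial m b' * (q_fact b * q_fact a)
          + Polynomial.monom 1 b * (gauss_binomial m b * (q_fact b * q_fact a))"
      by (simp only: distrib_right mult.assoc)
    also have "\<dots> = q_fact m * q_int b + Polynomial.monom 1 b * (q_fact m * q_int a)"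
      by (simp only: fst snd)
    also have "\<dots> = q_fact m * q_int (b + a)"
      by (subst q_int_add) (simp add: algebra_simps)
    also have "\<dots> = q_fact (a + b)"
      using m b by (simp add: q_fact_Suc add.commute)
    finally show ?thesis .
  qed
qed

lemma poly_q_int: "(x - 1) * poly (q_int m) x = x ^ m - 1"
  by (simp add: q_int_def poly_sum poly_monom power_diff_1_eq)

lemma q_fact_nonzero: "q_fact m \<noteq> 0"
proof -
  have "poly (q_int i) 1 \<noteq> 0" if "i \<ge> 1" for i
    using that by (simp add: q_int_def poly_sum poly_monom)
  then have "poly (q_fact m) 1 \<noteq> 0"
    by (simp add: q_fact_def poly_prod)
  then show ?thesis by auto
qed

lemma q_binomial_eq_gauss_binomial:
  assumes "b \<le> a"
  shows "q_binomial a b = gauss_binomial a b"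
proof -
  have "gauss_binomial a b * (q_fact b * q_fact (a - b)) = q_fact a"
    using gauss_binomial_mult_q_fact[of "a - b" b] assms by simp
  then show ?thesis
    by (metis q_fact_nonzero no_zero_divisors nonzero_mult_div_cancel_right q_binomial_def)
qed

lemma poly_q_fact_nonzero:
  assumes "primitive_root_of_unity d \<omega>" and "j < d"
  shows "poly (q_fact j) \<omega> \<noteq> 0"
proof -
  have "poly (q_int i) \<omega> \<noteq> 0" if "1 \<le> i" "i \<le> j" for i
    using poly_q_int[of \<omega> i] assms that by (auto simp: primitive_root_of_unity_def)
  then show ?thesis by (simp add: q_fact_def poly_prod)
qed

text \<open>
  The numerator \<open>q_fact d\<close> contains the factor \<open>q_int d\<close>, which vanishes at a primitive \<open>d\<close>-th root of
  unity, whereas the \<open>q\<close>-integers in the denominator are all shorter and do not.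
\<close>

lemma poly_gauss_binomial_self:
  assumes "primitive_root_of_unity d \<omega>" and "0 < b" and "b < d"
  shows "poly (gauss_binomial d b) \<omega> = 0"
proof -
  have d: "\<omega> \<noteq> 1" "\<omega> ^ d = 1"
    using assms by (auto simp: primitive_root_of_unity_def)
  then have "poly (q_int d) \<omega> = 0"
    using poly_q_int[of \<omega> d] by simp
  moreover have "q_fact d = q_fact (d - 1) * q_int d"
    using assms q_fact_Suc[of "d - 1"] by simp
  ultimately have "poly (q_fact d) \<omega> = 0" by simp
  then have "poly (gauss_binomial d b) \<omega> * (poly (q_fact b) \<omega> * poly (q_fact (d - b)) \<omega>) = 0"
    using gauss_binomial_mult_q_fact[of "d - b" b] assms by (metis le_add_diff_inverse2 less_imp_le poly_mult)
  then show ?thesis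
    using poly_q_fact_nonzero[OF assms(1), of b] poly_q_fact_nonzero[OF assms(1), of "d - b"] assms
    by simp
qed

text \<open>
  This is the effect of adding \<open>d\<close> points to the upper index, the case of the \<open>q\<close>-Vandermonde identity
  in which all middle terms vanish. By induction on \<open>a\<close>, it is inherited
  through the Pascal rule, whose weights \<open>\<omega> ^ b\<close> and \<open>\<omega> ^ (b - d)\<close> coincide.
\<close>

lemma poly_gauss_binomial_add_order:
  assumes "primitive_root_of_unity d \<omega>"
  shows "poly (gauss_binomial (a + d) b) \<omega>
       = poly (gauss_binomial a b) \<omega> + (if d \<le> b then poly (gauss_binomial a (b - d)) \<omega> else 0)"
proof (induction a arbitrary: b)
  case 0
  have "poly (gauss_binomial d d) \<omega> = 1"
    using gauss_binomial_mult_q_fact[of 0 d] q_fact_nonzero[of d] by (simp add: q_fact_0)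
  moreover have "d > 0" using assms by (simp add: primitive_root_of_unity_def)
  ultimately show ?case
    using poly_gauss_binomial_self[OF assms, of b] gauss_binomial_eq_0[of d b]
      gauss_binomial_eq_0[of 0 b] gauss_binomial_eq_0[of 0 "b - d"]
    by (cases "b < d"; cases "b = d"; cases "b = 0") auto
next
  case (Suc a)
  have d: "d > 0" "\<omega> ^ d = 1" using assms by (auto simp: primitive_root_of_unity_def)
  show ?case
  proof (cases b)
    case 0
    then show ?thesis using d by simp
  next
    case b: (Suc b')
    have pascal: "poly (gauss_binomial (Suc c) b) \<omega>
        = poly (gauss_binomial c b') \<omega> + \<omega> ^ b * poly (gauss_binomial c b) \<omega>" for c
      by (simp add: b poly_monom)
    consider "b < d" | "b = d" | c where "b = Suc c + d"
      by (metis less_imp_Suc_add nat_neq_iff add.commute add_Suc)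
    then show ?thesis
    proof cases
      case 1
      then show ?thesis using b pascal[of a] pascal[of "a + d"] Suc.IH by simp
    next
      case 2
      then show ?thesis
        using b d pascal[of a] pascal[of "a + d"] Suc.IH[of b'] Suc.IH[of b] by simp
    next
      case 3
      then have c: "b' = c + d" "b - d = Suc c" and pow: "\<omega> ^ b = \<omega> ^ Suc c"
        using b d by (simp_all add: power_add)
      have IH1: "poly (gauss_binomial (a + d) b') \<omega> = poly (gauss_binomial a b') \<omega> + poly (gauss_binomial a c) \<omega>"
        using Suc.IH[of b'] c by simp
      have IH2: "poly (gauss_binomial (a + d) b) \<omega> = poly (gauss_binomial a b) \<omega> + poly (gauss_binomial a (Suc c)) \<omega>"
        using Suc.IH[of b] 3 c by simp
      have lower: "poly (gauss_binomial (Suc a) (Suc c)) \<omega>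
          = poly (gauss_binomial a c) \<omega> + \<omega> ^ Suc c * poly (gauss_binomial a (Suc c)) \<omega>"
        by (simp add: poly_monom)
      have "poly (gauss_binomial (Suc a + d) b) \<omega>
          = poly (gauss_binomial (Suc a) b) \<omega> + poly (gauss_binomial (Suc a) (Suc c)) \<omega>"
        unfolding add_Suc pascal lower IH1 IH2 pow by (simp only: distrib_left ac_simps)
      then show ?thesis using 3 c by simp
    qed
  qed
qed

section \<open>Invariant subsets of a free cyclic action\<close>

text \<open>
  The hypotheses say that \<open>h\<close> permutes \<open>X\<close> in cycles of length exactly \<open>d\<close>. Removing one cycle
  \<open>orb\<close> splits the invariant sets into those that miss \<open>orb\<close> and those that contain it, which is
  the recurrence of \<open>poly_gauss_binomial_add_order\<close>.
\<close>

lemma card_invariant_subsets: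
  assumes \<omega>: "primitive_root_of_unity d \<omega>"
    and "finite X" and "h ` X \<subseteq> X"
    and "\<And>x. x \<in> X \<Longrightarrow> (h ^^ d) x = x"
    and "\<And>x i. x \<in> X \<Longrightarrow> 0 < i \<Longrightarrow> i < d \<Longrightarrow> (h ^^ i) x \<noteq> x"
  shows "of_nat (card {B. B \<subseteq> X \<and> card B = b \<and> h ` B = B}) = poly (gauss_binomial (card X) b) \<omega>"
  using assms(2-)
proof (induction "card X" arbitrary: X b rule: less_induct)
  case less
  note fin = less.prems(1) and hX = less.prems(2) and per = less.prems(3) and free = less.prems(4)
  have d: "d > 0" using \<omega> by (simp add: primitive_root_of_unity_def)
  show ?case
  proof (cases "X = {}")
    case True
    then have "{B. B \<subseteq> X \<and> card B = b \<and> h ` B = B} = (if b = 0 then {{}} else {})" by auto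
    then show ?thesis using True by (cases b) auto
  next
    case False
    then obtain x where x: "x \<in> X" by auto
    define orb where "orb = (\<lambda>i. (h ^^ i) x) ` {..<d}"
    have powX: "(h ^^ i) y \<in> X" if "y \<in> X" for i y
      using that hX by (induction i) auto
    have pow_orb: "(h ^^ m) x \<in> orb" for m
      using funpow_mod_eq[OF per[OF x], of m] d by (auto simp: orb_def image_iff intro!: bexI[of _ "m mod d"])
    have orbX: "orb \<subseteq> X"
      using powX[OF x] by (auto simp: orb_def)
    \<comment> \<open>\<open>h ^^ (d - 1)\<close> inverts \<open>h\<close>, so \<open>h\<close> is injective on \<open>X\<close>.\<close>
    have undo: "(h ^^ (d - 1)) (h y) = y" if "y \<in> X" for y
      using per[OF that] d by (metis Suc_diff_1 comp_apply funpow_Suc_right)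
    have inj: "inj_on h X"
      using undo by (metis inj_onI)
    have ne: "(h ^^ i) x \<noteq> (h ^^ j) x" if "i < j" "j < d" for i j
    proof
      assume eq: "(h ^^ i) x = (h ^^ j) x"
      \<comment> \<open>Moving both points on by \<open>d - j\<close> steps closes the cycle from \<open>j\<close>, so \<open>x\<close> returns too early.\<close>
      have bounds: "0 < d - j + i" "d - j + i < d" using that by linarith+
      have "(h ^^ (d - j + i)) x = (h ^^ (d - j)) ((h ^^ j) x)"
        by (simp add: funpow_add eq)
      also have "\<dots> = (h ^^ (d - j + j)) x"
        by (simp only: funpow_add o_apply)
      also have "\<dots> = x"
        using per[OF x] that by simp
      finally show False
        using free[OF x bounds] by contradiction
    qed
    have "inj_on (\<lambda>i. (h ^^ i) x) {..<d}"
    proof (rule inj_onI)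
      fix i j assume "i \<in> {..<d}" "j \<in> {..<d}" "(h ^^ i) x = (h ^^ j) x"
      then show "i = j" using ne[of i j] ne[of j i] by (cases i j rule: linorder_cases) auto
    qed
    then have card_orb: "card orb = d"
      by (simp add: orb_def card_image)
    have fin_orb: "finite orb"
      by (simp add: orb_def)
    have "h ` orb \<subseteq> orb"
    proof (rule image_subsetI)
      fix y assume "y \<in> orb"
      then obtain i where "y = (h ^^ i) x" by (auto simp: orb_def)
      then show "h y \<in> orb" using pow_orb[of "Suc i"] by simp
    qed
    then have h_orb: "h ` orb = orb"
      by (rule endo_inj_surj[OF fin_orb _ inj_on_subset[OF inj orbX]])
    define Y where "Y = X - orb"
    have hY: "h ` Y \<subseteq> Y"
      unfolding Y_def using inj_on_image_set_diff[OF inj, of X orb] h_orb hX orbX by auto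
    have cardY: "card X = card Y + d"
      using card_Diff_subset[OF fin_orb orbX] card_mono[OF fin orbX] card_orb by (simp add: Y_def)
    have IH: "of_nat (card {B. B \<subseteq> Y \<and> card B = c \<and> h ` B = B}) = poly (gauss_binomial (card Y) c) \<omega>" for c
      by (rule less.hyps) (use cardY d fin hY per free in \<open>auto simp: Y_def\<close>)
    define I where "I = (\<lambda>Z c. {B. B \<subseteq> Z \<and> card B = c \<and> h ` B = B})"
    have orb_dichotomy: "orb \<subseteq> B" if B: "B \<subseteq> X" "h ` B = B" and "orb \<inter> B \<noteq> {}" for B
    proof -
      have powB: "(h ^^ i) y \<in> B" if "y \<in> B" for i y
        using that B(2) by (induction i) auto
      obtain i where i: "i < d" "(h ^^ i) x \<in> B"
        using \<open>orb \<inter> B \<noteq> {}\<close> by (auto simp: orb_def)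
      have "(h ^^ (d - i)) ((h ^^ i) x) = (h ^^ (d - i + i)) x"
        by (simp only: funpow_add o_apply)
      then have "x \<in> B"
        using powB[OF i(2), of "d - i"] per[OF x] i(1) by simp
      then show ?thesis using powB by (auto simp: orb_def)
    qed
    have split: "I X b = I Y b \<union> (if d \<le> b then (\<lambda>B. orb \<union> B) ` I Y (b - d) else {})" (is "_ = ?R")
    proof (intro equalityI subsetI)
      fix B assume "B \<in> I X b"
      then have B: "B \<subseteq> X" "card B = b" "h ` B = B" by (auto simp: I_def)
      show "B \<in> ?R"
      proof (cases "orb \<inter> B = {}")
        case True
        then show ?thesis using B by (auto simp: I_def Y_def)
      next
        case False
        then have sub: "orb \<subseteq> B" using orb_dichotomy B by blast
        then have "d \<le> b"
          using card_mono[OF finite_subset[OF B(1) fin] sub] B(2) card_orb by simp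
        moreover have "h ` (B - orb) = B - orb"
          using inj_on_image_set_diff[OF inj, of B orb] B(1,3) orbX h_orb by auto
        then have "B - orb \<in> I Y (b - d)"
          using B card_orb card_Diff_subset[OF fin_orb sub] by (auto simp: I_def Y_def)
        ultimately show ?thesis using sub by (auto simp: image_iff intro!: bexI[of _ "B - orb"])
      qed
    next
      fix B assume "B \<in> ?R"
      then consider "B \<in> I Y b" | C where "d \<le> b" "B = orb \<union> C" "C \<in> I Y (b - d)"
        by (auto split: if_splits)
      then show "B \<in> I X b"
      proof cases
        case 1
        then show ?thesis by (auto simp: I_def Y_def)
      next
        case 2
        then have "finite C" "orb \<inter> C = {}"
          using fin by (auto simp: I_def Y_def intro: finite_subset)
        then have "card B = b"
          using 2 card_orb fin_orb by (simp add: I_def card_Un_disjoint)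
        then show ?thesis
          using 2 orbX h_orb by (auto simp: I_def Y_def image_Un)
      qed
    qed
    have finI: "finite (I Y c)" for c
      by (rule finite_subset[of _ "Pow Y"]) (use fin in \<open>auto simp: I_def Y_def\<close>)
    have "card (I X b) = card (I Y b) + (if d \<le> b then card (I Y (b - d)) else 0)"
    proof (cases "d \<le> b")
      case True
      have "inj_on (\<lambda>B. orb \<union> B) (I Y (b - d))"
        by (rule inj_onI) (auto simp: I_def Y_def)
      moreover have "I Y b \<inter> (\<lambda>B. orb \<union> B) ` I Y (b - d) = {}"
        using pow_orb[of 0] by (auto simp: I_def Y_def)
      ultimately show ?thesis
        using True finI by (simp add: split card_Un_disjoint card_image)
    qed (simp add: split)
    then show ?thesis
      using IH poly_gauss_binomial_add_order[OF \<omega>, of "card Y" b] by (simp add: I_def cardY)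
  qed
qed

section \<open>Actions on sets, graphs and whiskerings\<close>

text \<open>The inverse group element provides the inverse map, so each \<open>\<phi> g\<close> is a bijection.\<close>

lemma group_actionI:
  assumes "group C"
    and ext: "\<And>g. g \<in> carrier C \<Longrightarrow> \<phi> g \<in> extensional E"
    and closed: "\<And>g x. g \<in> carrier C \<Longrightarrow> x \<in> E \<Longrightarrow> \<phi> g x \<in> E"
    and one: "\<And>x. x \<in> E \<Longrightarrow> \<phi> \<one>\<^bsub>C\<^esub> x = x"
    and mult: "\<And>g h x. g \<in> carrier C \<Longrightarrow> h \<in> carrier C \<Longrightarrow> x \<in> E \<Longrightarrow> \<phi> (g \<otimes>\<^bsub>C\<^esub> h) x = \<phi> g (\<phi> h x)"
  shows "group_action C E \<phi>"
proof -
  interpret group C by fact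
  have bij: "\<phi> g \<in> Bij E" if "g \<in> carrier C" for g
  proof -
    have "bij_betw (\<phi> g) E E"
      by (rule bij_betw_byWitness[where f' = "\<phi> (inv\<^bsub>C\<^esub> g)"])
        (use that closed one mult[symmetric] in auto)
    then show ?thesis using ext[OF that] by (simp add: Bij_def)
  qed
  have "\<phi> (g \<otimes>\<^bsub>C\<^esub> h) = compose E (\<phi> g) (\<phi> h)" if "g \<in> carrier C" "h \<in> carrier C" for g h
    by (rule extensionalityI[of _ E]) (use that ext mult in \<open>auto simp: compose_def\<close>)
  then have "\<phi> \<in> hom C (BijGroup E)"
    using bij by (auto simp: hom_def BijGroup_def)
  then show ?thesis
    by (simp add: group_action_def group_hom_def group_hom_axioms_def group_BijGroup group_axioms)
qed

lemma group_action_one: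
  assumes "group_action C X \<phi>" and "x \<in> X"
  shows "\<phi> \<one>\<^bsub>C\<^esub> x = x"
  using group_action.id_eq_one[OF assms(1)] assms(2) by (metis restrict_apply')

lemma group_action_set_action:
  assumes "group_action C V \<psi>"
    and sub: "\<And>S. S \<in> \<S> \<Longrightarrow> S \<subseteq> V"
    and closed: "\<And>g S. g \<in> carrier C \<Longrightarrow> S \<in> \<S> \<Longrightarrow> \<psi> g ` S \<in> \<S>"
  shows "group_action C \<S> (set_action \<S> \<psi>)"
proof -
  interpret group_action C V \<psi> by fact
  interpret group C using group_hom by (rule group_hom.axioms(1))
  show ?thesis
  proof (rule group_actionI)
    show "group C" by (rule group_axioms)
    show "set_action \<S> \<psi> g \<in> extensional \<S>" for g
      by (simp add: set_action_def)
    show "set_action \<S> \<psi> g S \<in> \<S>" if "g \<in> carrier C" "S \<in> \<S>" for g S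
      using that closed by (simp add: set_action_def)
    show "set_action \<S> \<psi> \<one>\<^bsub>C\<^esub> S = S" if "S \<in> \<S>" for S
      using that sub[OF that] group_action_one[OF assms(1)]
      by (auto simp: set_action_def subset_iff image_iff)
    show "set_action \<S> \<psi> (g \<otimes>\<^bsub>C\<^esub> h) S = set_action \<S> \<psi> g (set_action \<S> \<psi> h S)"
      if "g \<in> carrier C" "h \<in> carrier C" "S \<in> \<S>" for g h S
      using that closed[of h S] composition_rule[of _ g h] sub[of S]
      by (force simp: set_action_def image_image intro!: image_cong)
  qed
qed

lemma invariants_set_action:
  "invariants \<S> (set_action \<S> \<psi>) g = {S \<in> \<S>. \<psi> g ` S = S}"
  by (auto simp: invariants_def set_action_def)

lemma group_action_pow:
  assumes "group_action C X \<phi>" and "g \<in> carrier C" and "x \<in> X"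
  shows "\<phi> (g [^]\<^bsub>C\<^esub> (i::nat)) x = (\<phi> g ^^ i) x"
proof -
  interpret group_action C X \<phi> by fact
  interpret group C using group_hom by (rule group_hom.axioms(1))
  show ?thesis using assms(3)
  proof (induction i arbitrary: x)
    case 0
    then show ?case using group_action_one[OF assms(1)] by simp
  next
    case (Suc i)
    have "\<phi> g x \<in> X" using element_image[OF assms(2) Suc.prems] by simp
    then show ?case
      using Suc assms(2) composition_rule[of x "g [^]\<^bsub>C\<^esub> i" g]
      by (simp add: funpow_Suc_right del: funpow.simps)
  qed
qed

text \<open>
  Freeness makes all cycles of \<open>g\<close> equally long: a power of \<open>g\<close> that fixes a single point is the
  identity.
\<close>

lemma free_action_pow_fixes:
  assumes "free_action C X \<phi>" and "g \<in> carrier C" and "x \<in> X"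
  shows "(\<phi> g ^^ i) x = x \<longleftrightarrow> group.ord C g dvd i"
proof -
  have act: "group_action C X \<phi>" using assms(1) by (simp add: free_action_def)
  interpret group_action C X \<phi> by fact
  interpret group C using group_hom by (rule group_hom.axioms(1))
  have "(\<phi> g ^^ i) x = x \<longleftrightarrow> g [^]\<^bsub>C\<^esub> i = \<one>\<^bsub>C\<^esub>"
    using assms group_action_pow[OF act assms(2,3), of i] group_action_one[OF act assms(3)]
    unfolding free_action_def by (metis nat_pow_closed)
  then show ?thesis using pow_eq_id[OF assms(2)] by simp
qed

lemma acts_on_graph_whiskering:
  assumes "group C" and "acts_on_graph C G \<phi>"
  shows "acts_on_graph C (whiskering G) (whiskering_action G \<phi>)"
proof -
  have act: "group_action C (pverts G) \<phi>"
    and adj: "\<And>g u v. g \<in> carrier C \<Longrightarrow> u \<in> pverts G \<Longrightarrow> v \<in> pverts G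
                \<Longrightarrow> (\<phi> g u, \<phi> g v) \<in> parcs G \<longleftrightarrow> (u, v) \<in> parcs G"
    using assms(2) by (auto simp: acts_on_graph_def)
  interpret group_action C "pverts G" \<phi> by (rule act)
  have closed: "\<phi> g v \<in> pverts G" if "g \<in> carrier C" "v \<in> pverts G" for g v
    using element_image that by blast
  have inj: "\<phi> g u = \<phi> g v \<longleftrightarrow> u = v" if "g \<in> carrier C" "u \<in> pverts G" "v \<in> pverts G" for g u v
    using inj_prop[OF that(1)] that(2,3) by (auto dest: inj_onD)
  have "group_action C (pverts (whiskering G)) (whiskering_action G \<phi>)"
    by (rule group_actionI)
      (auto simp: assms(1) whiskering_action_def whiskering_def closed composition_rule
        group_action_one[OF act])
  then show ?thesis
    by (auto simp: acts_on_graph_def whiskering_action_def whiskering_def adj inj closed)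
qed

lemma indep_sets_image:
  assumes "acts_on_graph C G \<phi>" and "g \<in> carrier C" and "S \<in> indep_sets G k"
  shows "\<phi> g ` S \<in> indep_sets G k"
proof -
  have act: "group_action C (pverts G) \<phi>"
    using assms(1) by (simp add: acts_on_graph_def)
  have S: "S \<subseteq> pverts G" using assms(3) by (simp add: indep_sets_def)
  have "inj_on (\<phi> g) S"
    using group_action.inj_prop[OF act assms(2)] S by (rule inj_on_subset)
  then have "card (\<phi> g ` S) = card S" by (rule card_image)
  moreover have "\<phi> g ` S \<subseteq> pverts G"
    using group_action.surj_prop[OF act assms(2)] S by blast
  ultimately show ?thesis
    using assms S unfolding acts_on_graph_def indep_sets_def by (auto simp: subset_iff)
qed

section \<open>Independent sets of the whiskering\<close>

lemma Plus_eq_iff: "A <+> B = C <+> D \<longleftrightarrow> A = C \<and> B = D"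
  by (auto simp: set_eq_iff Plus_def image_iff)

lemma vimage_Plus: "S = (Inl -` S) <+> (Inr -` S)"
proof (rule Set.set_eqI)
  show "x \<in> S \<longleftrightarrow> x \<in> (Inl -` S) <+> (Inr -` S)" for x
    by (cases x) auto
qed

text \<open>
  Whisker tips are pairwise non-adjacent, and a tip is adjacent only to its own base vertex; so the
  only constraint on \<open>B\<close> is disjointness from \<open>A\<close>.
\<close>

lemma Plus_in_indep_sets_whiskering:
  assumes "pair_graph G"
  shows "A <+> B \<in> indep_sets (whiskering G) k \<longleftrightarrow>
    A \<in> indep_sets G (card A) \<and> B \<subseteq> pverts G - A \<and> card A + card B = k"
proof -
  interpret pair_graph G by fact
  have card: "card (A <+> B) = card A + card B" if "A \<subseteq> pverts G" "B \<subseteq> pverts G"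
    using that pair_finite_verts by (simp add: card_Plus finite_subset)
  have sub: "A <+> B \<subseteq> pverts (whiskering G) \<longleftrightarrow> A \<subseteq> pverts G \<and> B \<subseteq> pverts G"
    by (auto simp: whiskering_def)
  have edges: "(\<forall>u\<in>A <+> B. \<forall>v\<in>A <+> B. (u, v) \<notin> parcs (whiskering G)) \<longleftrightarrow>
      (\<forall>u\<in>A. \<forall>v\<in>A. (u, v) \<notin> parcs G) \<and> A \<inter> B = {}"
    if "A \<subseteq> pverts G" "B \<subseteq> pverts G"
    using that by (auto simp: whiskering_def Plus_def ball_Un)
  show ?thesis
  proof (cases "A \<subseteq> pverts G \<and> B \<subseteq> pverts G")
    case True
    then have "A <+> B \<in> indep_sets (whiskering G) k \<longleftrightarrow>
        card A + card B = k \<and> (\<forall>u\<in>A. \<forall>v\<in>A. (u, v) \<notin> parcs G) \<and> A \<inter> B = {}"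
      by (simp only: indep_sets_def mem_Collect_eq card sub edges True simp_thms)
    then show ?thesis
      using True by (auto simp: indep_sets_def)
  next
    case False
    then have "A <+> B \<notin> indep_sets (whiskering G) k"
      by (simp only: indep_sets_def mem_Collect_eq sub simp_thms)
    then show ?thesis
      using False by (auto simp: indep_sets_def)
  qed
qed

text \<open>
  Since \<open>map_sum h h\<close> keeps vertices and tips apart, invariance of \<open>A <+> B\<close> splits into invariance
  of \<open>A\<close> and of \<open>B\<close>, and the pairs can be counted by the size \<open>j\<close> of \<open>A\<close>.
\<close>

lemma card_invariant_indep_sets_whiskering:
  assumes "pair_graph G"
  shows "card {S \<in> indep_sets (whiskering G) k. map_sum h h ` S = S}
    = (\<Sum>j=0..k. \<Sum>A \<in> {A \<in> indep_sets G j. h ` A = A}.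
        card {B. B \<subseteq> pverts G - A \<and> card B = k - j \<and> h ` B = B})"
proof -
  interpret pair_graph G by fact
  define F where "F j = {A \<in> indep_sets G j. h ` A = A}" for j
  define I where "I A c = {B. B \<subseteq> pverts G - A \<and> card B = c \<and> h ` B = B}" for A c
  define P where "P = (SIGMA p : (SIGMA j : {0..k}. F j). I (snd p) (k - fst p))"
  have finF: "finite (F j)" for j
    by (rule finite_subset[of _ "Pow (pverts G)"]) (auto simp: F_def indep_sets_def pair_finite_verts)
  have finI: "finite (I A c)" for A c
    by (rule finite_subset[of _ "Pow (pverts G)"]) (auto simp: I_def pair_finite_verts)
  have F_card: "card A = j" if "A \<in> F j" for A j
    using that by (simp add: F_def indep_sets_def)
  have h_Plus: "map_sum h h ` (A <+> B) = A <+> B \<longleftrightarrow> h ` A = A \<and> h ` B = B" for A B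
  proof -
    have "map_sum h h ` (A <+> B) = h ` A <+> h ` B"
      by (auto simp: Plus_def image_Un image_image)
    then show ?thesis by (simp add: Plus_eq_iff)
  qed
  have "inj_on (\<lambda>((j, A), B). A <+> B) P"
  proof (rule inj_onI)
    fix p p'
    assume P: "p \<in> P" "p' \<in> P"
      and eq: "(\<lambda>((j, A), B). A <+> B) p = (\<lambda>((j, A), B). A <+> B) p'"
    obtain j A B j' A' B' where p: "p = ((j, A), B)" "p' = ((j', A'), B')"
      by (metis surj_pair)
    have "A = A'" "B = B'"
      using eq by (simp_all add: p Plus_eq_iff)
    moreover have "card A = j" "card A' = j'"
      using P by (auto simp: P_def p intro!: F_card)
    ultimately show "p = p'" by (simp add: p)
  qed
  moreover have "(\<lambda>((j, A), B). A <+> B) ` P = {S \<in> indep_sets (whiskering G) k. map_sum h h ` S = S}"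
  proof (intro equalityI subsetI)
    fix S assume "S \<in> (\<lambda>((j, A), B). A <+> B) ` P"
    then obtain j A B where "S = A <+> B" "j \<le> k" "A \<in> F j" "B \<in> I A (k - j)"
      by (auto simp: P_def)
    then show "S \<in> {S \<in> indep_sets (whiskering G) k. map_sum h h ` S = S}"
      using F_card[of A j] by (auto simp: Plus_in_indep_sets_whiskering[OF assms] h_Plus F_def I_def)
  next
    fix S assume S: "S \<in> {S \<in> indep_sets (whiskering G) k. map_sum h h ` S = S}"
    obtain A B where AB: "S = A <+> B" using vimage_Plus by blast
    have "((card A, A), B) \<in> P"
      using S unfolding AB by (auto simp: Plus_in_indep_sets_whiskering[OF assms] h_Plus F_def I_def P_def)
    then show "S \<in> (\<lambda>((j, A), B). A <+> B) ` P"
      unfolding AB by force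
  qed
  ultimately have "card {S \<in> indep_sets (whiskering G) k. map_sum h h ` S = S} = card P"
    by (metis (no_types, lifting) card_image)
  also have "\<dots> = (\<Sum>p \<in> (SIGMA j : {0..k}. F j). card (I (snd p) (k - fst p)))"
    unfolding P_def by (rule card_SigmaI) (auto simp: finF finI)
  also have "\<dots> = (\<Sum>j=0..k. \<Sum>A \<in> F j. card (I A (k - j)))"
    by (subst sum.Sigma) (auto simp: finF case_prod_beta)
  finally show ?thesis by (simp add: F_def I_def)
qed

theorem theorem3:
  fixes G :: "'v pair_pre_digraph" and C :: "'g monoid" and \<phi> :: "'g \<Rightarrow> 'v \<Rightarrow> 'v"
    and n k :: nat and f :: "nat \<Rightarrow> complex poly"
  assumes "pair_graph G" and "card (pverts G) = n" and "k \<le> n"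
    and "group C" and "cyclic_group C" and "finite (carrier C)"
    and "acts_on_graph C G \<phi>" and "free_action C (pverts G) \<phi>"
    and "\<And>j. j \<le> k \<Longrightarrow>
           exhibits_csp C (indep_sets G j) (set_action (indep_sets G j) \<phi>) (f j)"
  shows "acts_on_graph C (whiskering G) (whiskering_action G \<phi>) \<and>
         exhibits_csp C (indep_sets (whiskering G) k)
           (set_action (indep_sets (whiskering G) k) (whiskering_action G \<phi>))
           (\<Sum>j=0..k. f j * q_binomial (n - j) (k - j))"
proof -
  let ?W = "whiskering G" and ?\<psi> = "whiskering_action G \<phi>"
  interpret pair_graph G by fact
  interpret W: pair_graph ?W using assms(1) by (rule pair_graph_whiskering)
  have actW: "acts_on_graph C ?W ?\<psi>"
    using assms(4,7) by (rule acts_on_graph_whiskering)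
  have act: "group_action C (pverts G) \<phi>"
    using assms(7) by (simp add: acts_on_graph_def)
  have "finite (indep_sets ?W k)"
    by (rule finite_subset[of _ "Pow (pverts ?W)"]) (auto simp: indep_sets_def W.pair_finite_verts)
  moreover have "group_action C (indep_sets ?W k) (set_action (indep_sets ?W k) ?\<psi>)"
    by (rule group_action_set_action[of C "pverts ?W"])
      (use actW indep_sets_image[OF actW] in \<open>auto simp: acts_on_graph_def indep_sets_def\<close>)
  moreover have "of_nat (card (invariants (indep_sets ?W k) (set_action (indep_sets ?W k) ?\<psi>) g))
      = poly (\<Sum>j=0..k. f j * q_binomial (n - j) (k - j)) \<omega>"
    if g: "g \<in> carrier C" and \<omega>: "primitive_root_of_unity (group.ord C g) \<omega>" for g \<omega>
  proof -
    let ?h = "\<phi> g"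
    have whisk: "?\<psi> g ` S = map_sum ?h ?h ` S" if "S \<in> indep_sets ?W k" for S
      using that by (intro image_cong) (auto simp: indep_sets_def whiskering_action_def)
    \<comment> \<open>The count of the tips \<open>B\<close> is the same for all invariant \<open>A\<close> of size \<open>j\<close>, so it factors out.\<close>
    have copies: "of_nat (card {B. B \<subseteq> pverts G - A \<and> card B = k - j \<and> ?h ` B = B})
        = poly (q_binomial (n - j) (k - j)) \<omega>"
      if j: "j \<le> k" and A: "A \<in> indep_sets G j" "?h ` A = A" for j A
    proof -
      have sub: "A \<subseteq> pverts G" and "card A = j"
        using A(1) by (auto simp: indep_sets_def)
      then have "card (pverts G - A) = n - j"
        using assms(2) pair_finite_verts by (simp add: card_Diff_subset finite_subset)
      moreover have "?h ` (pverts G - A) \<subseteq> pverts G - A"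
        using inj_on_image_set_diff[OF group_action.inj_prop[OF act g], of "pverts G" A] sub A(2)
          group_action.surj_prop[OF act g] by auto
      then have "of_nat (card {B. B \<subseteq> pverts G - A \<and> card B = k - j \<and> ?h ` B = B})
          = poly (gauss_binomial (card (pverts G - A)) (k - j)) \<omega>"
        by (intro card_invariant_subsets[OF \<omega>])
          (auto simp: pair_finite_verts free_action_pow_fixes[OF assms(8) g] dest: dvd_imp_le)
      ultimately show ?thesis
        using q_binomial_eq_gauss_binomial[of "k - j" "n - j"] assms(3) by simp
    qed
    have csp: "of_nat (card {A \<in> indep_sets G j. ?h ` A = A}) = poly (f j) \<omega>" if "j \<le> k" for j
      using assms(9)[OF that] g \<omega> by (simp add: exhibits_csp_def invariants_set_action)
    have "invariants (indep_sets ?W k) (set_action (indep_sets ?W k) ?\<psi>) g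
        = {S \<in> indep_sets ?W k. map_sum ?h ?h ` S = S}"
      unfolding invariants_set_action by (intro Collect_cong conj_cong refl) (simp only: whisk)
    then have "complex_of_nat (card (invariants (indep_sets ?W k) (set_action (indep_sets ?W k) ?\<psi>) g))
        = (\<Sum>j=0..k. \<Sum>A \<in> {A \<in> indep_sets G j. ?h ` A = A}.
            of_nat (card {B. B \<subseteq> pverts G - A \<and> card B = k - j \<and> ?h ` B = B}))"
      by (simp add: card_invariant_indep_sets_whiskering[OF assms(1)])
    also have "\<dots> = (\<Sum>j=0..k. poly (f j) \<omega> * poly (q_binomial (n - j) (k - j)) \<omega>)"
      using csp by (intro sum.cong) (simp_all add: copies)
    finally show ?thesis by (simp add: poly_sum)
  qed
  ultimately show ?thesis
    using actW assms(4-6) by (simp add: exhibits_csp_def)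
qed

end
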